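(* Let $A$ be an incidence matrix of a symmetric $(v,k,\lambda)$ design, and let $L$ be a Latin square of order $v$. Then the array $B$ defined by $$B(x,y,z)=A\big(x,L(y,z)\big),\qquad x,y,z\in\{1,\dots,v\},$$ is a $\mathcal{C}^3_3(v,vk,v\lambda)$-cube.
   Context: An incidence matrix of a symmetric $(v,k,\lambda)$ design is a $v\times v$ matrix over $\{0,1\}$ with exactly $k$ ones in every row and column, such that the scalar product of any two distinct rows, and of any two distinct columns, is $\lambda$. A Latin square of order $v$ is a $v\times v$ matrix over $\{1,\dots,v\}$ in which each symbol appears exactly once in every row and column. A $v\times v\times v$ array is a function on $\{1,\dots,v\}^3$. A layer is obtained by fixing one of the three coordinates; two layers are parallel if they fix the same coordinate, to different values; their scalar product is the sum over all positions of the product of corresponding entries. A $\mathcal{C}^3_3(v,K,\Lambda)$-cube is a $v\times v\times v$ array over $\{0,1\}$ such that every layer (in each of the three directions) contains exactly $K$ ones and every two parallel layers have scalar product $\Lambda$. *)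

theory Defs
  imports Main
begin

text \<open>
  Matrices and three-dimensional arrays are functions on natural numbers of which only the
  values at indices in \<open>{1..v}\<close> matter; every condition below is restricted to that range.
\<close>

type_synonym matrix = "nat \<Rightarrow> nat \<Rightarrow> nat"
type_synonym array3 = "nat \<Rightarrow> nat \<Rightarrow> nat \<Rightarrow> nat"

definition symmetric_design_incidence_matrix :: "nat \<Rightarrow> nat \<Rightarrow> nat \<Rightarrow> matrix \<Rightarrow> bool" where
  "symmetric_design_incidence_matrix v k l A \<longleftrightarrow>
     (\<forall>i\<in>{1..v}. \<forall>j\<in>{1..v}. A i j \<in> {0, 1}) \<and>
     (\<forall>i\<in>{1..v}. card {j \<in> {1..v}. A i j = 1} = k) \<and>
     (\<forall>j\<in>{1..v}. card {i \<in> {1..v}. A i j = 1} = k) \<and>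
     (\<forall>i\<in>{1..v}. \<forall>i'\<in>{1..v}. i \<noteq> i' \<longrightarrow> (\<Sum>j=1..v. A i j * A i' j) = l) \<and>
     (\<forall>j\<in>{1..v}. \<forall>j'\<in>{1..v}. j \<noteq> j' \<longrightarrow> (\<Sum>i=1..v. A i j * A i j') = l)"

definition latin_square :: "nat \<Rightarrow> matrix \<Rightarrow> bool" where
  "latin_square v L \<longleftrightarrow>
     (\<forall>i\<in>{1..v}. \<forall>j\<in>{1..v}. L i j \<in> {1..v}) \<and>
     (\<forall>i\<in>{1..v}. \<forall>s\<in>{1..v}. \<exists>!j. j \<in> {1..v} \<and> L i j = s) \<and>
     (\<forall>j\<in>{1..v}. \<forall>s\<in>{1..v}. \<exists>!i. i \<in> {1..v} \<and> L i j = s)"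

datatype direction = First | Second | Third

fun layer :: "array3 \<Rightarrow> direction \<Rightarrow> nat \<Rightarrow> matrix" where
  "layer B First a = (\<lambda>y z. B a y z)"
| "layer B Second a = (\<lambda>x z. B x a z)"
| "layer B Third a = (\<lambda>x y. B x y a)"

definition layer_ones :: "nat \<Rightarrow> matrix \<Rightarrow> nat" where
  "layer_ones v M = card {(p, q). p \<in> {1..v} \<and> q \<in> {1..v} \<and> M p q = 1}"

definition layer_scalar_product :: "nat \<Rightarrow> matrix \<Rightarrow> matrix \<Rightarrow> nat" where
  "layer_scalar_product v M N = (\<Sum>p=1..v. \<Sum>q=1..v. M p q * N p q)"

text \<open>A \<open>\<C>\<^sup>3\<^sub>3(v, K, \<Lambda>)\<close>-cube; parallel layers are those fixing the same
  coordinate to different values.\<close>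

definition cube_C33 :: "nat \<Rightarrow> nat \<Rightarrow> nat \<Rightarrow> array3 \<Rightarrow> bool" where
  "cube_C33 v K \<Lambda> B \<longleftrightarrow>
     (\<forall>x\<in>{1..v}. \<forall>y\<in>{1..v}. \<forall>z\<in>{1..v}. B x y z \<in> {0, 1}) \<and>
     (\<forall>d. \<forall>a\<in>{1..v}. layer_ones v (layer B d a) = K) \<and>
     (\<forall>d. \<forall>a\<in>{1..v}. \<forall>b\<in>{1..v}. a \<noteq> b \<longrightarrow>
        layer_scalar_product v (layer B d a) (layer B d b) = \<Lambda>)"

end

(* For 0/1 arrays the number of ones in a layer is the scalar product of the layer with itself, so
   it suffices to compute the scalar products of layers a and b of the same direction, allowing
   a = b. In the first direction the rows L(y,.) are permutations, so each y contributes the scalar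
   product of rows a and b of A. In the other two directions each position on the remaining axis
   of L contributes the scalar product of two columns of A, which coincide iff a = b. *)
theory Submission
  imports Defs
begin

text \<open>Since 0 and 1 are idempotent, \<open>f x * f x\<close> is the indicator of
  \<open>f x = 1\<close>. This turns counts of ones into scalar products.\<close>

lemma card_ones_eq_sum:
  fixes f :: "'a \<Rightarrow> nat"
  assumes "finite S" "\<And>x. x \<in> S \<Longrightarrow> f x \<in> {0, 1}"
  shows "card {x \<in> S. f x = 1} = (\<Sum>x\<in>S. f x * f x)"
proof -
  have "(\<Sum>x\<in>S. f x * f x) = (\<Sum>x\<in>S. if f x = 1 then 1 else 0)"
    using assms(2) by (intro sum.cong) auto
  also have "\<dots> = card {x \<in> S. f x = 1}"
    using assms(1) by (simp flip: sum.inter_filter)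
  finally show ?thesis by simp
qed

lemma layer_ones_eq_scalar_product:
  assumes "\<And>p q. p \<in> {1..v} \<Longrightarrow> q \<in> {1..v} \<Longrightarrow> M p q \<in> {0, 1}"
  shows "layer_ones v M = layer_scalar_product v M M"
proof -
  \<comment> \<open>The matrix is uncurried so that \<open>card_ones_eq_sum\<close> applies with
    pairs as indices; \<open>sum.cartesian_product\<close> later restores the double sum.\<close>
  have entries: "case_prod M x \<in> {0, 1}" if "x \<in> {1..v} \<times> {1..v}" for x
    using assms[of "fst x" "snd x"] that by (simp only: mem_Times_iff case_prod_beta)
  have "layer_ones v M = card {x \<in> {1..v} \<times> {1..v}. case_prod M x = 1}"
    unfolding layer_ones_def by (rule arg_cong[where f = card]) auto
  also have "\<dots> = (\<Sum>x\<in>{1..v} \<times> {1..v}. case_prod M x * case_prod M x)"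
    by (rule card_ones_eq_sum[OF _ entries]) simp_all
  also have "\<dots> = layer_scalar_product v M M"
    by (simp add: layer_scalar_product_def sum.cartesian_product case_prod_beta)
  finally show ?thesis .
qed

text \<open>For \<open>i = i'\<close> the sum counts the ones of a 0/1 row. Merging this case with
  that of distinct rows lets one computation serve both cube conditions.\<close>

lemma design_row_product:
  assumes "symmetric_design_incidence_matrix v k l A" "i \<in> {1..v}" "i' \<in> {1..v}"
  shows "(\<Sum>j=1..v. A i j * A i' j) = (if i = i' then k else l)"
  using assms card_ones_eq_sum[of "{1..v}" "\<lambda>j. A i j"]
  unfolding symmetric_design_incidence_matrix_def by auto

lemma design_column_product:
  assumes "symmetric_design_incidence_matrix v k l A" "j \<in> {1..v}" "j' \<in> {1..v}"
  shows "(\<Sum>i=1..v. A i j * A i j') = (if j = j' then k else l)"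
  using assms card_ones_eq_sum[of "{1..v}" "\<lambda>i. A i j"]
  unfolding symmetric_design_incidence_matrix_def by auto

lemma latin_square_entry:
  assumes "latin_square v L" "i \<in> {1..v}" "j \<in> {1..v}"
  shows "L i j \<in> {1..v}"
  using assms unfolding latin_square_def by blast

text \<open>No symbol repeats in a row, so the row is an injective self-map of a finite set, hence
  onto.\<close>

lemma latin_square_row_bij:
  assumes "latin_square v L" "i \<in> {1..v}"
  shows "bij_betw (L i) {1..v} {1..v}"
proof -
  have "inj_on (L i) {1..v}"
    using assms unfolding latin_square_def inj_on_def by metis
  then show ?thesis
    using latin_square_entry[OF assms]
    by (metis bij_betw_imageI endo_inj_surj finite_atLeastAtMost image_subsetI)
qed

lemma latin_square_row_eq_iff:
  assumes "latin_square v L" "i \<in> {1..v}" "j \<in> {1..v}" "j' \<in> {1..v}"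
  shows "L i j = L i j' \<longleftrightarrow> j = j'"
  using assms unfolding latin_square_def by metis

lemma latin_square_column_eq_iff:
  assumes "latin_square v L" "i \<in> {1..v}" "i' \<in> {1..v}" "j \<in> {1..v}"
  shows "L i j = L i' j \<longleftrightarrow> i = i'"
  using assms unfolding latin_square_def by metis

lemma parallel_layers_product:
  fixes B :: array3
  assumes A: "symmetric_design_incidence_matrix v k l A" and L: "latin_square v L"
    and B: "\<And>x y z. \<lbrakk>x \<in> {1..v}; y \<in> {1..v}; z \<in> {1..v}\<rbrakk> \<Longrightarrow> B x y z = A x (L y z)"
    and a: "a \<in> {1..v}" and b: "b \<in> {1..v}"
  shows "layer_scalar_product v (layer B d a) (layer B d b) = v * (if a = b then k else l)"
proof (cases d)
  case First
  have "layer_scalar_product v (layer B d a) (layer B d b)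
      = (\<Sum>y=1..v. \<Sum>z=1..v. A a (L y z) * A b (L y z))"
    unfolding layer_scalar_product_def First using a b by (intro sum.cong refl) (simp add: B)
  \<comment> \<open>For fixed \<open>y\<close>, substitute \<open>s = L y z\<close>; the inner sum
    no longer depends on \<open>y\<close>.\<close>
  also have "\<dots> = (\<Sum>y=1..v. \<Sum>s=1..v. A a s * A b s)"
    by (intro sum.cong refl sum.reindex_bij_betw latin_square_row_bij[OF L])
  also have "\<dots> = v * (if a = b then k else l)"
    by (simp only: design_row_product[OF A a b] sum_constant card_atLeastAtMost) simp
  finally show ?thesis .
next
  case Second
  have "layer_scalar_product v (layer B d a) (layer B d b)
      = (\<Sum>x=1..v. \<Sum>z=1..v. A x (L a z) * A x (L b z))"
    unfolding layer_scalar_product_def Second using a b by (intro sum.cong refl) (simp add: B)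
  \<comment> \<open>With \<open>x\<close> innermost, the inner sum is the product of columns
    \<open>L a z\<close> and \<open>L b z\<close> of \<open>A\<close>.\<close>
  also have "\<dots> = (\<Sum>z=1..v. \<Sum>x=1..v. A x (L a z) * A x (L b z))"
    by (rule sum.swap)
  \<comment> \<open>Both symbols lie in column \<open>z\<close> of \<open>L\<close>, so they agree
    exactly when \<open>a = b\<close>.\<close>
  also have "\<dots> = (\<Sum>z=1..v. if a = b then k else l)"
    using a b by (intro sum.cong refl)
      (simp only: design_column_product[OF A] latin_square_entry[OF L]
        latin_square_column_eq_iff[OF L])
  finally show ?thesis by simp
next
  case Third
  have "layer_scalar_product v (layer B d a) (layer B d b)
      = (\<Sum>x=1..v. \<Sum>y=1..v. A x (L y a) * A x (L y b))"
    unfolding layer_scalar_product_def Third using a b by (intro sum.cong refl) (simp add: B)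
  also have "\<dots> = (\<Sum>y=1..v. \<Sum>x=1..v. A x (L y a) * A x (L y b))"
    by (rule sum.swap)
  \<comment> \<open>Here the symbols \<open>L y a\<close> and \<open>L y b\<close> share row
    \<open>y\<close> of \<open>L\<close>, so distinctness within a row decides.\<close>
  also have "\<dots> = (\<Sum>y=1..v. if a = b then k else l)"
    using a b by (intro sum.cong refl)
      (simp only: design_column_product[OF A] latin_square_entry[OF L]
        latin_square_row_eq_iff[OF L])
  finally show ?thesis by simp
qed

theorem theorem4p1:
  fixes v k l :: nat and A L :: matrix and B :: array3
  assumes "symmetric_design_incidence_matrix v k l A"
    and "latin_square v L"
    and "\<And>x y z. \<lbrakk>x \<in> {1..v}; y \<in> {1..v}; z \<in> {1..v}\<rbrakk> \<Longrightarrow> B x y z = A x (L y z)"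
  shows "cube_C33 v (v * k) (v * l) B"
proof -
  have bin: "B x y z \<in> {0, 1}" if "x \<in> {1..v}" "y \<in> {1..v}" "z \<in> {1..v}" for x y z
    using assms(1) latin_square_entry[OF assms(2)] that
    unfolding assms(3)[OF that] symmetric_design_incidence_matrix_def by blast
  have "layer B d a p q \<in> {0, 1}" if "a \<in> {1..v}" "p \<in> {1..v}" "q \<in> {1..v}" for d a p q
    using that bin by (cases d) (simp_all only: layer.simps)
  \<comment> \<open>The product lemma is taken with both layers equal, which selects the value
    \<open>k\<close>.\<close>
  then have "layer_ones v (layer B d a) = v * k" if "a \<in> {1..v}" for d a
    using that parallel_layers_product[OF assms that that]
    by (simp only: layer_ones_eq_scalar_product simp_thms if_True)
  then show ?thesis
    unfolding cube_C33_def using bin parallel_layers_product[OF assms] by simp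
qed

end
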